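(* Let $n\ge 2$ and let $C_n=\mathrm{conv}\{\pm e_1,\ldots,\pm e_n\}\subset\mathbb{R}^n$ be the regular crosspolytope, where $e_1,\ldots,e_n$ are the standard coordinate vectors. Then $$\Lambda(C_n)\ge \frac{(n-1)!\,2^{n/2}}{n^{n-1}}\ \text{ if $n$ is even},\qquad \Lambda(C_n)\ge \frac{(n-1)!\,2^{(n-1)/2}}{n^{n-1}}\ \text{ if $n$ is odd}.$$
   Context: A frame is an orthonormal basis $F=\{u_1,\ldots,u_n\}$ of $\mathbb{R}^n$. $K|u^\perp$ denotes the orthogonal projection of $K$ onto the hyperplane $u^\perp$ through the origin perpendicular to $u$. The LW-constant of a convex body $K\subset\mathbb{R}^n$ (compact, convex, nonempty interior) is $$\Lambda(K)=\max_F \frac{\mathrm{vol}_n(K)^{n-1}}{\prod_{i=1}^n \mathrm{vol}_{n-1}(K|u_i^\perp)},$$ the maximum being over all frames $F=\{u_1,\ldots,u_n\}$ of $\mathbb{R}^n$. *)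

theory Defs
  imports "HOL-Analysis.Analysis"
begin

definition orthonormal_basis_of :: "'a::euclidean_space set \<Rightarrow> 'a set \<Rightarrow> bool" where
  "orthonormal_basis_of V B \<longleftrightarrow>
     pairwise orthogonal B \<and> (\<forall>b\<in>B. norm b = 1) \<and> span B = V"

abbreviation frame :: "'a::euclidean_space set \<Rightarrow> bool" where
  "frame \<equiv> orthonormal_basis_of UNIV"

text \<open>
  Lebesgue measure on a linear subspace \<open>V\<close>, as a measure on the Borel sets of the ambient
  space: the coordinates with respect to an orthonormal basis of \<open>V\<close> identify \<open>V\<close> with a
  product of copies of the real line (this is how \<^const>\<open>lborel\<close> arises from the standard
  basis). An orthonormal basis exists for every subspace, and by rotation invariance of
  Lebesgue measure its choice does not matter.
\<close>
definition subspace_lborel :: "'a::euclidean_space set \<Rightarrow> 'a measure" where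
  "subspace_lborel V =
     (let B = (SOME B. orthonormal_basis_of V B)
      in distr (\<Pi>\<^sub>M b\<in>B. lborel) borel (\<lambda>f. \<Sum>b\<in>B. f b *\<^sub>R b))"

definition hyperplane_proj :: "'a::euclidean_space \<Rightarrow> 'a \<Rightarrow> 'a" where
  "hyperplane_proj u x = x - ((x \<bullet> u) / (u \<bullet> u)) *\<^sub>R u"

definition proj_volume :: "'a::euclidean_space set \<Rightarrow> 'a \<Rightarrow> real" where
  "proj_volume K u = measure (subspace_lborel {x. u \<bullet> x = 0}) (hyperplane_proj u ` K)"

text \<open>
  The maximum over all frames is taken literally, as the greatest element of the set of
  values. (\<^const>\<open>Max\<close> is meaningful only for finite sets.)
\<close>
definition LW_constant :: "'a::euclidean_space set \<Rightarrow> real" where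
  "LW_constant K =
     (GREATEST r. \<exists>F. frame F \<and>
        r = measure lebesgue K ^ (DIM('a) - 1) / (\<Prod>u\<in>F. proj_volume K u))"

definition crosspolytope :: "(real ^ 'n) set" where
  "crosspolytope = convex hull (range (\<lambda>i. axis i 1) \<union> range (\<lambda>i. - axis i 1))"

lemma ex_orthonormal_basis_of:
  assumes "subspace V"
  shows "\<exists>B. orthonormal_basis_of V B"
  using orthonormal_basis_subspace[OF assms] unfolding orthonormal_basis_of_def by metis

lemma orthogonal_hyperplane_proj: "u \<bullet> hyperplane_proj u x = 0"
  by (cases "u = 0") (auto simp: hyperplane_proj_def inner_diff_right inner_commute)

end

theory Submission
  imports Defs
begin

text \<open>
  For \<open>i \<noteq> j\<close> the projection of the crosspolytope along \<open>(\<plusminus>e\<^sub>i + e\<^sub>j) / \<surd>2\<close> is an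
  \<open>(n-1)\<close>-dimensional crosspolytope with one axis shrunk by \<open>\<surd>2\<close>, so it has volume
  \<open>2\<^bsup>n-1\<^esup> / ((n-1)! \<surd>2)\<close>, against \<open>2\<^bsup>n-1\<^esup> / (n-1)!\<close> along a coordinate direction. Pair up the
  coordinates, leaving one over if \<open>n\<close> is odd, and take the frame of the vectors
  \<open>(e\<^sub>i \<plusminus> e\<^sub>j) / \<surd>2\<close> over all pairs; this gains the factor \<open>2\<^bsup>\<lfloor>n/2\<rfloor>\<^esup>\<close>.
  The maximum defining the constant is attained because projection volumes depend continuously
  on the direction and the set of frames is compact.
\<close>

section \<open>Lebesgue measure in orthonormal coordinates\<close>

text \<open>
  By Fubini and translation invariance, \<open>\<lambda>(A) M(B) = \<lambda>(B) M(-A)\<close> with \<open>\<lambda>\<close> the Lebesgue measure;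
  the unit ball \<open>A = -A\<close> then fixes the normalisation.
\<close>
lemma lborel_eqI_translation_invariant:
  fixes M :: "'a::euclidean_space measure"
  assumes sets: "sets M = sets borel" and sf: "sigma_finite_measure M"
    and transl: "\<And>a. distr M borel ((+) a) = M"
    and ball: "emeasure M (cball 0 1) = emeasure lborel (cball (0::'a) 1)"
  shows "M = lborel"
proof (rule measure_eqI)
  show "sets M = sets lborel" using sets by simp
  interpret M: sigma_finite_measure M by fact
  interpret pair_sigma_finite lborel M by standard
  have [measurable_cong]: "sets M = sets borel" by fact
  have M_shift: "(\<integral>\<^sup>+y. f y \<partial>M) = (\<integral>\<^sup>+y. f (a + y) \<partial>M)"
    if [measurable]: "f \<in> borel_measurable borel" for f :: "'a \<Rightarrow> ennreal" and a
  proof -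
    have "(\<integral>\<^sup>+y. f y \<partial>M) = (\<integral>\<^sup>+y. f y \<partial>distr M borel ((+) a))" by (simp only: transl)
    also have "\<dots> = (\<integral>\<^sup>+y. f (a + y) \<partial>M)" by (subst nn_integral_distr) auto
    finally show ?thesis .
  qed
  have L_shift: "(\<integral>\<^sup>+y. f y \<partial>lborel) = (\<integral>\<^sup>+y. f (a + y) \<partial>lborel)"
    if [measurable]: "f \<in> borel_measurable borel" for f :: "'a \<Rightarrow> ennreal" and a
  proof -
    have "(\<integral>\<^sup>+y. f y \<partial>lborel) = (\<integral>\<^sup>+y. f y \<partial>distr lborel borel ((+) a))"
      by (simp only: lborel_distr_plus)
    also have "\<dots> = (\<integral>\<^sup>+y. f (a + y) \<partial>lborel)" by (subst nn_integral_distr) auto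
    finally show ?thesis .
  qed
  fix B assume "B \<in> sets M"
  then have B[measurable]: "B \<in> sets borel" using sets by simp
  define A :: "'a set" where "A = cball 0 1"
  have [measurable]: "A \<in> sets borel" by (simp add: A_def)
  let ?a = "indicator A :: 'a \<Rightarrow> ennreal" and ?b = "indicator B :: 'a \<Rightarrow> ennreal"
  have "emeasure lborel A * emeasure M B = (\<integral>\<^sup>+x. ?a x * (\<integral>\<^sup>+y. ?b y \<partial>M) \<partial>lborel)"
    by (subst nn_integral_multc) (auto simp: sets)
  \<comment> \<open>For each fixed \<open>x\<close>, invariance of \<open>M\<close> replaces
    \<open>y\<close> by \<open>x + y\<close>; this couples the variables so that the two measures
    can exchange roles.\<close>
  also have "\<dots> = (\<integral>\<^sup>+x. (\<integral>\<^sup>+y. ?a x * ?b (x + y) \<partial>M) \<partial>lborel)"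
  proof (rule nn_integral_cong)
    fix x
    have "(\<integral>\<^sup>+y. ?a x * ?b (x + y) \<partial>M) = ?a x * (\<integral>\<^sup>+y. ?b (x + y) \<partial>M)"
      by (subst nn_integral_cmult) auto
    then show "?a x * (\<integral>\<^sup>+y. ?b y \<partial>M) = (\<integral>\<^sup>+y. ?a x * ?b (x + y) \<partial>M)"
      by (simp only: M_shift[of ?b x, OF borel_measurable_indicator[OF B]])
  qed
  also have "\<dots> = (\<integral>\<^sup>+y. (\<integral>\<^sup>+x. ?a x * ?b (x + y) \<partial>lborel) \<partial>M)"
    by (rule Fubini'[symmetric]) measurable
  \<comment> \<open>Invariance of Lebesgue measure substitutes \<open>x - y\<close> for
    \<open>x\<close>, moving the shift from \<open>B\<close> to \<open>A\<close>.\<close>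
  also have "\<dots> = (\<integral>\<^sup>+y. (\<integral>\<^sup>+x. ?a (- y + x) * ?b x \<partial>lborel) \<partial>M)"
  proof (rule nn_integral_cong)
    fix y
    show "(\<integral>\<^sup>+x. ?a x * ?b (x + y) \<partial>lborel) = (\<integral>\<^sup>+x. ?a (- y + x) * ?b x \<partial>lborel)"
      by (subst L_shift[of "\<lambda>x. ?a x * ?b (x + y)" "- y"]) auto
  qed
  also have "\<dots> = (\<integral>\<^sup>+x. (\<integral>\<^sup>+y. ?a (- y + x) * ?b x \<partial>M) \<partial>lborel)"
    by (rule Fubini') measurable
  \<comment> \<open>Substituting \<open>x + y\<close> for \<open>y\<close> leaves
    \<open>?a (- y)\<close>, and the ball is symmetric about the origin.\<close>
  also have "\<dots> = (\<integral>\<^sup>+x. (\<integral>\<^sup>+y. ?a y * ?b x \<partial>M) \<partial>lborel)"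
  proof (rule nn_integral_cong)
    fix x
    have "(\<integral>\<^sup>+y. ?a (- y + x) * ?b x \<partial>M) = (\<integral>\<^sup>+y. ?a (- y) * ?b x \<partial>M)"
      by (subst M_shift[of "\<lambda>y. ?a (- y + x) * ?b x" x]) auto
    then show "(\<integral>\<^sup>+y. ?a (- y + x) * ?b x \<partial>M) = (\<integral>\<^sup>+y. ?a y * ?b x \<partial>M)"
      by (simp add: A_def indicator_def)
  qed
  also have "\<dots> = emeasure lborel B * emeasure M A"
    by (subst nn_integral_multc, simp, subst nn_integral_cmult)
       (auto simp: sets mult.commute)
  finally have "emeasure lborel A * emeasure M B = emeasure lborel B * emeasure M A" .
  moreover have "emeasure M A = emeasure lborel A" by (simp add: A_def ball)
  moreover have "emeasure lborel A \<noteq> 0" "emeasure lborel A \<noteq> \<infinity>"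
    using emeasure_lborel_cball_finite[of "0::'a" 1] unit_ball_vol_pos[of "real DIM('a)", THEN less_imp_neq[THEN not_sym]]
    by (simp_all add: A_def emeasure_cball)
  ultimately show "emeasure M B = emeasure lborel B"
    by (simp add: mult.commute[of "emeasure lborel B"] ennreal_mult_cancel_left)
qed

section \<open>Coordinates in an orthonormal basis and rotation invariance\<close>

lemma orthonormal_basis_of_finite:
  "orthonormal_basis_of V B \<Longrightarrow> finite B"
  unfolding orthonormal_basis_of_def
  by (metis pairwise_orthogonal_imp_finite)

lemma orthonormal_basis_of_inner:
  "orthonormal_basis_of V B \<Longrightarrow> b \<in> B \<Longrightarrow> c \<in> B \<Longrightarrow> b \<bullet> c = (if b = c then 1 else 0)"
  by (auto simp: orthonormal_basis_of_def pairwise_def orthogonal_def norm_eq_1)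

lemma orthonormal_basis_of_inner_sum:
  assumes "orthonormal_basis_of V B" "b \<in> B"
  shows "(\<Sum>c\<in>B. f c *\<^sub>R c) \<bullet> b = f b"
proof -
  have "(\<Sum>c\<in>B. f c *\<^sub>R c) \<bullet> b = (\<Sum>c\<in>B. if c = b then f c else 0)"
    using orthonormal_basis_of_inner[OF assms(1) _ assms(2)]
    by (auto simp: inner_sum_left intro!: sum.cong)
  also have "\<dots> = f b" using orthonormal_basis_of_finite[OF assms(1)] assms(2) by simp
  finally show ?thesis .
qed

lemma orthonormal_basis_of_expand:
  assumes "orthonormal_basis_of V B" "x \<in> V"
  shows "(\<Sum>b\<in>B. (x \<bullet> b) *\<^sub>R b) = x"
  using assms orthonormal_basis_of_finite[OF assms(1)] orthonormal_basis_expand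
  unfolding orthonormal_basis_of_def by blast

lemma orthonormal_basis_of_norm_sum:
  assumes "orthonormal_basis_of V B"
  shows "norm (\<Sum>b\<in>B. f b *\<^sub>R b) = sqrt (\<Sum>b\<in>B. (f b)\<^sup>2)"
  by (auto simp: norm_eq_sqrt_inner inner_sum_right orthonormal_basis_of_inner_sum[OF assms]
      power2_eq_square intro!: sum.cong)

lemma orthonormal_basis_of_card:
  assumes "frame (B :: 'a::euclidean_space set)"
  shows "card B = DIM('a)"
proof -
  have "independent B" using assms unfolding orthonormal_basis_of_def
    by (intro pairwise_orthogonal_independent) auto
  then show ?thesis using assms unfolding orthonormal_basis_of_def
    by (metis dim_UNIV indep_card_eq_dim_span)
qed

interpretation lborel_product: product_sigma_finite "\<lambda>_. lborel :: real measure"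
  by standard

text \<open>Values on boxes determine the measure, and there the translation splits into
  one-dimensional translations.\<close>

lemma distr_PiM_lborel_translation:
  assumes "finite B"
  shows "distr (\<Pi>\<^sub>M b\<in>B. lborel) (\<Pi>\<^sub>M b\<in>B. lborel) (\<lambda>f. \<lambda>b\<in>B. f b + a b)
         = (\<Pi>\<^sub>M b\<in>B. (lborel :: real measure))"
proof (rule lborel_product.PiM_eqI[OF assms])
  fix A :: "_ \<Rightarrow> real set" assume A: "\<And>i. i \<in> B \<Longrightarrow> A i \<in> sets lborel"
  have A': "(\<lambda>t. a i + t) -` A i \<in> sets borel" if "i \<in> B" for i
    using A[OF that] by (intro measurable_sets_borel[of _ borel]) auto
  have "emeasure (distr (\<Pi>\<^sub>M b\<in>B. lborel) (\<Pi>\<^sub>M b\<in>B. lborel) (\<lambda>f. \<lambda>b\<in>B. f b + a b)) (Pi\<^sub>E B A)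
     = emeasure (\<Pi>\<^sub>M b\<in>B. lborel) (Pi\<^sub>E B (\<lambda>b. (\<lambda>t. a b + t) -` A b))"
    using assms A by (subst emeasure_distr)
      (auto simp: space_PiM PiE_iff ac_simps extensional_def intro!: arg_cong[where f="emeasure _"])
  also have "\<dots> = (\<Prod>b\<in>B. emeasure lborel ((\<lambda>t. a b + t) -` A b))"
    using assms by (intro lborel_product.emeasure_PiM) (auto simp: A')
  also have "\<dots> = (\<Prod>b\<in>B. emeasure lborel (A b))"
  proof (rule prod.cong[OF refl])
    fix b assume b: "b \<in> B"
    have "emeasure lborel (A b) = emeasure (distr lborel borel ((+) (a b))) (A b)"
      by (simp only: lborel_distr_plus)
    also have "\<dots> = emeasure lborel ((\<lambda>t. a b + t) -` A b)"
      using A[OF b] by (subst emeasure_distr) auto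
    finally show "emeasure lborel ((\<lambda>t. a b + t) -` A b) = emeasure lborel (A b)" by simp
  qed
  finally show "emeasure (distr (\<Pi>\<^sub>M b\<in>B. lborel) (\<Pi>\<^sub>M b\<in>B. lborel) (\<lambda>f. \<lambda>b\<in>B. f b + a b)) (Pi\<^sub>E B A)
     = (\<Prod>b\<in>B. emeasure lborel (A b))" .
qed auto

text \<open>This is rotation invariance of Lebesgue measure. Norms are Euclidean norms of
  coordinates, so balls get the right volume, and translating the space by \<open>a\<close>
  translates the coordinates by \<open>a \<bullet> b\<close>; the characterisation by translation
  invariance then applies.\<close>

lemma lborel_orthonormal_basis:
  assumes B: "frame (B :: 'a::euclidean_space set)"
  shows "distr (\<Pi>\<^sub>M b\<in>B. lborel) borel (\<lambda>f. \<Sum>b\<in>B. f b *\<^sub>R b) = lborel" (is "?M = _")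
proof (rule lborel_eqI_translation_invariant)
  have fin: "finite B" using B by (rule orthonormal_basis_of_finite)
  have cball: "emeasure ?M (cball 0 r) = emeasure lborel (cball (0::'a) r)" if "r > 0" for r
  proof -
    have "emeasure ?M (cball 0 r) = emeasure (\<Pi>\<^sub>M b\<in>B. lborel)
        ({f. sqrt (\<Sum>b\<in>B. (f b)\<^sup>2) \<le> r} \<inter> space (\<Pi>\<^sub>M b\<in>B. lborel))"
      using fin by (subst emeasure_distr)
        (auto simp: orthonormal_basis_of_norm_sum[OF B] intro!: arg_cong[where f="emeasure _"])
    then show ?thesis
      using fin that by (simp add: emeasure_cball_aux emeasure_cball orthonormal_basis_of_card[OF B])
  qed
  show "sets ?M = sets borel" by simp
  show "emeasure ?M (cball 0 1) = emeasure lborel (cball (0::'a) 1)" by (rule cball) simp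
  show "sigma_finite_measure ?M"
  proof
    let ?A = "range (\<lambda>n. cball (0::'a) (real (Suc n)))"
    have "\<exists>n. norm x \<le> real (Suc n)" for x :: 'a
      using real_arch_simple[of "norm x"] by (metis le_Suc_eq of_nat_mono order_refl order_trans)
    then have "\<Union> ?A = UNIV" by auto
    moreover have "emeasure ?M (cball 0 (real (Suc n))) \<noteq> \<infinity>" for n
      using emeasure_lborel_cball_finite[of "0::'a" "real (Suc n)"] cball[of "real (Suc n)"] by simp
    ultimately show "\<exists>A. countable A \<and> A \<subseteq> sets ?M \<and> \<Union> A = space ?M \<and> (\<forall>a\<in>A. emeasure ?M a \<noteq> \<infinity>)"
      by (intro exI[of _ ?A]) (simp add: image_subset_iff)
  qed
  fix a :: 'a
  have "distr ?M borel ((+) a) = distr (\<Pi>\<^sub>M b\<in>B. lborel) borel (\<lambda>f. a + (\<Sum>b\<in>B. f b *\<^sub>R b))"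
    using fin by (subst distr_distr) (auto simp: comp_def)
  also have "\<dots> = distr (\<Pi>\<^sub>M b\<in>B. lborel) borel
      ((\<lambda>f. \<Sum>b\<in>B. f b *\<^sub>R b) \<circ> (\<lambda>f. \<lambda>b\<in>B. f b + a \<bullet> b))"
    by (intro distr_cong)
      (simp_all add: scaleR_left_distrib sum.distrib orthonormal_basis_of_expand[OF B])
  also have "\<dots> = distr (distr (\<Pi>\<^sub>M b\<in>B. lborel) (\<Pi>\<^sub>M b\<in>B. lborel) (\<lambda>f. \<lambda>b\<in>B. f b + a \<bullet> b))
      borel (\<lambda>f. \<Sum>b\<in>B. f b *\<^sub>R b)"
    using fin by (subst distr_distr) auto
  also have "\<dots> = ?M" by (simp only: distr_PiM_lborel_translation[OF fin])
  finally show "distr ?M borel ((+) a) = ?M" .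
qed

section \<open>Projection volumes as volumes of cylinders\<close>

text \<open>Removing the component of \<open>x\<close> along \<open>u\<close> leaves a point of the
  hyperplane. The enlarged basis splits the ambient space into height along \<open>u\<close> and
  hyperplane coordinates.\<close>

lemma frame_insert_hyperplane_basis:
  assumes u: "norm u = 1" and B: "orthonormal_basis_of {x. u \<bullet> x = 0} B"
  shows "u \<notin> B" and "frame (insert u B)"
proof -
  have perp: "u \<bullet> b = 0" if "b \<in> B" for b
    using B that span_base[of b B] by (auto simp: orthonormal_basis_of_def)
  have "u \<bullet> u = 1" using u by (simp add: norm_eq_1)
  then show "u \<notin> B" using perp by force
  have "x \<in> span (insert u B)" for x
  proof -
    have "x - (x \<bullet> u) *\<^sub>R u \<in> {x. u \<bullet> x = 0}"
      using \<open>u \<bullet> u = 1\<close> by (simp add: inner_diff_right inner_commute)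
    then have "x - (x \<bullet> u) *\<^sub>R u \<in> span B"
      using B by (simp add: orthonormal_basis_of_def)
    then show ?thesis by (auto simp: span_insert)
  qed
  then show "frame (insert u B)"
    using B u perp by (auto simp: orthonormal_basis_of_def pairwise_insert orthogonal_def inner_commute)
qed

text \<open>
  The cylinder of height 1 over the projection of \<open>K\<close>: its Lebesgue measure in the ambient space is
  the projection volume, which removes the choice of basis made in \<^const>\<open>subspace_lborel\<close>.
\<close>
definition unit_cylinder :: "'a::euclidean_space set \<Rightarrow> 'a \<Rightarrow> 'a set" where
  "unit_cylinder K u = {x. 0 \<le> x \<bullet> u \<and> x \<bullet> u \<le> 1 \<and> (\<exists>t. x + t *\<^sub>R u \<in> K)}"

text \<open>Two points have the same projection exactly when they differ by a multiple of
  \<open>u\<close>.\<close>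

lemma mem_hyperplane_proj_image_iff:
  assumes "norm u = 1"
  shows "hyperplane_proj u x \<in> hyperplane_proj u ` K \<longleftrightarrow> (\<exists>t. x + t *\<^sub>R u \<in> K)"
proof
  have uu: "u \<bullet> u = 1" using assms by (simp add: norm_eq_1)
  {
    assume "hyperplane_proj u x \<in> hyperplane_proj u ` K"
    then obtain k where k: "k \<in> K" "x - (x \<bullet> u) *\<^sub>R u = k - (k \<bullet> u) *\<^sub>R u"
      by (auto simp: hyperplane_proj_def uu)
    then have "x + (k \<bullet> u - x \<bullet> u) *\<^sub>R u = k" by (simp add: algebra_simps)
    with k(1) show "\<exists>t. x + t *\<^sub>R u \<in> K" by metis
  next
    assume "\<exists>t. x + t *\<^sub>R u \<in> K"
    then obtain t where t: "x + t *\<^sub>R u \<in> K" ..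
    have "hyperplane_proj u x = hyperplane_proj u (x + t *\<^sub>R u)"
      by (simp add: hyperplane_proj_def uu inner_add_left algebra_simps)
    then show "hyperplane_proj u x \<in> hyperplane_proj u ` K" using t by blast
  }
qed

lemma continuous_on_hyperplane_proj: "continuous_on A (hyperplane_proj u)"
proof (cases "u = 0")
  case False
  then show ?thesis unfolding hyperplane_proj_def by (intro continuous_intros) simp
qed (simp add: hyperplane_proj_def)

lemma closed_unit_cylinder:
  assumes "norm u = 1" "compact K"
  shows "closed (unit_cylinder K u)"
proof -
  have "unit_cylinder K u = {x. 0 \<le> x \<bullet> u} \<inter> {x. x \<bullet> u \<le> 1} \<inter>
      hyperplane_proj u -` (hyperplane_proj u ` K)"
    by (auto simp: unit_cylinder_def mem_hyperplane_proj_image_iff[OF assms(1), symmetric])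
  also have "closed \<dots>"
    using assms(2) by (intro closed_Int closed_Collect_le closed_vimage compact_imp_closed
        compact_continuous_image continuous_intros continuous_on_hyperplane_proj)
  finally show ?thesis .
qed

text \<open>In the coordinates of \<open>insert u B\<close> the cylinder is the product of
  \<open>{0..1}\<close> along \<open>u\<close> with the projection, so Fubini gives the claim for
  every choice of \<open>B\<close>.\<close>

lemma emeasure_hyperplane_proj:
  fixes u :: "'a::euclidean_space"
  assumes u: "norm u = 1" and B: "orthonormal_basis_of {x. u \<bullet> x = 0} B" and K: "compact K"
  shows "emeasure (distr (\<Pi>\<^sub>M b\<in>B. lborel) borel (\<lambda>f. \<Sum>b\<in>B. f b *\<^sub>R b)) (hyperplane_proj u ` K)
    = emeasure lborel (unit_cylinder K u)"
proof -
  define P where "P = hyperplane_proj u ` K"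
  define C where "C = unit_cylinder K u"
  have fin: "finite B" using B by (rule orthonormal_basis_of_finite)
  note uB = frame_insert_hyperplane_basis[OF u B]
  have "closed P" unfolding P_def
    using K by (intro compact_imp_closed compact_continuous_image continuous_on_hyperplane_proj)
  then have P[measurable]: "P \<in> sets borel" by simp
  have C[measurable]: "C \<in> sets borel" using closed_unit_cylinder[OF u K] by (simp add: C_def)
  let ?S = "\<lambda>B f. \<Sum>b\<in>B. f b *\<^sub>R b :: 'a"
  have mem: "?S (insert u B) (f(u := y)) \<in> C \<longleftrightarrow> y \<in> {0..1} \<and> ?S B f \<in> P" for f y
  proof -
    have S: "?S (insert u B) (f(u := y)) = y *\<^sub>R u + ?S B f"
      using uB(1) fin by (auto intro!: sum.cong)
    have "b \<bullet> u = 0" if "b \<in> B" for b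
      using that uB orthonormal_basis_of_inner[OF uB(2), of b u] by auto
    then have "?S B f \<bullet> u = 0" by (simp add: inner_sum_left)
    then have inner: "?S (insert u B) (f(u := y)) \<bullet> u = y" and proj: "hyperplane_proj u (?S B f) = ?S B f"
      unfolding S using u by (simp_all add: inner_add_left hyperplane_proj_def norm_eq_1)
    have "(\<exists>t. ?S (insert u B) (f(u := y)) + t *\<^sub>R u \<in> K) \<longleftrightarrow> (\<exists>t. ?S B f + (y + t) *\<^sub>R u \<in> K)"
      unfolding S by (simp add: algebra_simps)
    \<comment> \<open>The height \<open>y\<close> is absorbed by the free parameter
      \<open>t\<close>, so only the hyperplane coordinates matter.\<close>
    also have "\<dots> \<longleftrightarrow> (\<exists>t. ?S B f + t *\<^sub>R u \<in> K)"
      by (metis add_diff_cancel_left' diff_add_cancel add.commute)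
    also have "\<dots> \<longleftrightarrow> ?S B f \<in> P"
      by (simp add: mem_hyperplane_proj_image_iff[OF u, symmetric] P_def proj)
    finally show ?thesis unfolding C_def unit_cylinder_def using inner by auto
  qed
  have "emeasure lborel C = emeasure (distr (\<Pi>\<^sub>M b\<in>insert u B. lborel) borel (?S (insert u B))) C"
    by (simp only: lborel_orthonormal_basis[OF uB(2)])
  also have "\<dots> = (\<integral>\<^sup>+f. indicator C f \<partial>distr (\<Pi>\<^sub>M b\<in>insert u B. lborel) borel (?S (insert u B)))"
    by simp
  also have "\<dots> = (\<integral>\<^sup>+f. indicator C (?S (insert u B) f) \<partial>(\<Pi>\<^sub>M b\<in>insert u B. lborel))"
    using fin by (subst nn_integral_distr) auto
  also have "\<dots> = (\<integral>\<^sup>+f. (\<integral>\<^sup>+y. indicator C (?S (insert u B) (f(u := y))) \<partial>lborel) \<partial>(\<Pi>\<^sub>M b\<in>B. lborel))"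
    using fin uB(1) by (intro lborel_product.product_nn_integral_insert) auto
  also have "\<dots> = (\<integral>\<^sup>+f. (\<integral>\<^sup>+y. indicator {0..1::real} y * indicator P (?S B f) \<partial>lborel) \<partial>(\<Pi>\<^sub>M b\<in>B. lborel))"
    by (intro nn_integral_cong) (simp only: indicator_def mem, simp)
  also have "\<dots> = (\<integral>\<^sup>+f. indicator P (?S B f) \<partial>(\<Pi>\<^sub>M b\<in>B. lborel))"
    by (subst nn_integral_multc) auto
  also have "\<dots> = (\<integral>\<^sup>+f. indicator P f \<partial>distr (\<Pi>\<^sub>M b\<in>B. lborel) borel (?S B))"
    using fin by (subst nn_integral_distr) auto
  also have "\<dots> = emeasure (distr (\<Pi>\<^sub>M b\<in>B. lborel) borel (?S B)) P" by simp
  finally show ?thesis by (simp add: C_def P_def)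
qed

lemma proj_volume_eq_measure_cylinder:
  assumes "norm u = 1" "compact K"
  shows "proj_volume K u = measure lborel (unit_cylinder K u)"
proof -
  have "orthonormal_basis_of {x. u \<bullet> x = 0} (SOME B. orthonormal_basis_of {x. u \<bullet> x = 0} B)"
    by (rule someI_ex[OF ex_orthonormal_basis_of[OF subspace_hyperplane]])
  from emeasure_hyperplane_proj[OF assms(1) this assms(2)] show ?thesis
    by (simp add: proj_volume_def subspace_lborel_def Let_def measure_def)
qed

section \<open>Continuity of the projection volume\<close>

text \<open>With strict inequalities and the interior, membership of a point survives a small change
  of \<open>u\<close>; for a convex body the two cylinders differ only by a null set.\<close>

definition open_unit_cylinder :: "'a::euclidean_space set \<Rightarrow> 'a \<Rightarrow> 'a set" where
  "open_unit_cylinder K u = {x. 0 < x \<bullet> u \<and> x \<bullet> u < 1 \<and> (\<exists>t. x + t *\<^sub>R u \<in> interior K)}"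

lemma open_unit_cylinder_subset: "open_unit_cylinder K u \<subseteq> unit_cylinder K u"
  using interior_subset by (fastforce simp: open_unit_cylinder_def unit_cylinder_def)

lemma open_open_unit_cylinder: "open (open_unit_cylinder K u)"
proof -
  have "open_unit_cylinder K u = {x. 0 < x \<bullet> u} \<inter> {x. x \<bullet> u < 1} \<inter>
      (\<Union>t. (\<lambda>x. x + t *\<^sub>R u) -` interior K)"
    by (auto simp: open_unit_cylinder_def)
  also have "open \<dots>"
    by (intro open_Int open_Collect_less open_UN open_vimage continuous_intros ballI open_interior)
  finally show ?thesis .
qed

lemma convex_open_unit_cylinder:
  assumes "convex K"
  shows "convex (open_unit_cylinder K u)"
proof -
  have "convex {x. \<exists>t. x + t *\<^sub>R u \<in> interior K}"
  proof (rule convexI, clarify)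
    fix x y and a b s t :: real
    assume "a \<ge> 0" "b \<ge> 0" "a + b = 1" "x + s *\<^sub>R u \<in> interior K" "y + t *\<^sub>R u \<in> interior K"
    then have "a *\<^sub>R (x + s *\<^sub>R u) + b *\<^sub>R (y + t *\<^sub>R u) \<in> interior K"
      using convex_interior[OF assms] by (auto simp: convex_def)
    then have "(a *\<^sub>R x + b *\<^sub>R y) + (a * s + b * t) *\<^sub>R u \<in> interior K"
      by (simp add: algebra_simps)
    then show "\<exists>t. (a *\<^sub>R x + b *\<^sub>R y) + t *\<^sub>R u \<in> interior K" ..
  qed
  moreover have "open_unit_cylinder K u = {x. u \<bullet> x > 0} \<inter> {x. u \<bullet> x < 1} \<inter> {x. \<exists>t. x + t *\<^sub>R u \<in> interior K}"
    by (auto simp: open_unit_cylinder_def inner_commute)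
  ultimately show ?thesis
    by (simp add: convex_Int convex_halfspace_gt convex_halfspace_lt)
qed

text \<open>Sliding \<open>z\<close> along \<open>u\<close> to height 1/2 stays on the same line,
  which still meets the interior.\<close>

lemma centre_in_open_unit_cylinder:
  assumes u: "norm u = 1" and "z \<in> interior K"
  shows "z + (1 / 2 - z \<bullet> u) *\<^sub>R u \<in> open_unit_cylinder K u" (is "?c \<in> _")
proof -
  have "?c \<bullet> u = 1 / 2" using u by (simp add: inner_add_left norm_eq_1)
  moreover have "?c + (- (1 / 2 - z \<bullet> u)) *\<^sub>R u \<in> interior K" using assms(2) by (simp add: algebra_simps)
  ultimately show ?thesis by (auto simp: open_unit_cylinder_def)
qed

text \<open>The segment from a point of the cylinder towards a point at height 1/2 over the interior
  of \<open>K\<close> runs in the open cylinder, apart from its starting point.\<close>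

lemma unit_cylinder_subset_closure:
  assumes u: "norm u = 1" and K: "convex K" "interior K \<noteq> {}"
  shows "unit_cylinder K u \<subseteq> closure (open_unit_cylinder K u)"
proof
  fix x assume "x \<in> unit_cylinder K u"
  then obtain t where x: "0 \<le> x \<bullet> u" "x \<bullet> u \<le> 1" "x + t *\<^sub>R u \<in> K"
    by (auto simp: unit_cylinder_def)
  obtain z where z: "z \<in> interior K" using K by auto
  define r where "r = 1 / 2 - z \<bullet> u"
  define c where "c = z + r *\<^sub>R u"
  have cu: "c \<bullet> u = 1 / 2" using u by (simp add: c_def r_def inner_add_left norm_eq_1)
  have mem: "x - e *\<^sub>R (x - c) \<in> open_unit_cylinder K u" if e: "0 < e" "e \<le> 1" for e
  proof -
    have "(x - e *\<^sub>R (x - c)) \<bullet> u = (1 - e) * (x \<bullet> u) + e * (1 / 2)"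
      using cu by (simp add: inner_diff_left algebra_simps)
    moreover have "0 \<le> (1 - e) * (x \<bullet> u)" "(1 - e) * (x \<bullet> u) \<le> 1 - e"
      using e x mult_left_mono[of "x \<bullet> u" 1 "1 - e"] by auto
    moreover have "(x + t *\<^sub>R u) - e *\<^sub>R ((x + t *\<^sub>R u) - z) \<in> interior K"
      using K(1) z x(3) e by (rule mem_interior_convex_shrink)
    \<comment> \<open>The points obtained by shrinking towards \<open>c\<close> and towards
      \<open>z\<close> lie on one line parallel to \<open>u\<close>; the coefficient is their
      difference along it.\<close>
    then have "(x - e *\<^sub>R (x - c)) + (t - e * t - e * r) *\<^sub>R u \<in> interior K"
      by (simp add: c_def algebra_simps)
    ultimately show ?thesis using e unfolding open_unit_cylinder_def by auto
  qed
  show "x \<in> closure (open_unit_cylinder K u)"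
    unfolding closure_sequential
  proof (intro exI conjI allI)
    show "x - inverse (real (Suc n)) *\<^sub>R (x - c) \<in> open_unit_cylinder K u" for n
      by (rule mem) (auto simp: field_simps)
    have "(\<lambda>n. x - inverse (real (Suc n)) *\<^sub>R (x - c)) \<longlonglongrightarrow> x - 0 *\<^sub>R (x - c)"
      by (intro tendsto_intros LIMSEQ_inverse_real_of_nat)
    then show "(\<lambda>n. x - inverse (real (Suc n)) *\<^sub>R (x - c)) \<longlonglongrightarrow> x" by simp
  qed
qed

text \<open>The difference lies in the frontier of a convex set, which is negligible.\<close>

lemma AE_unit_cylinder:
  assumes "norm u = 1" "convex K" "interior K \<noteq> {}"
  shows "AE x in lborel. x \<in> unit_cylinder K u \<longrightarrow> x \<in> open_unit_cylinder K u"
proof (rule AE_I)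
  show "{x \<in> space lborel. \<not> (x \<in> unit_cylinder K u \<longrightarrow> x \<in> open_unit_cylinder K u)}
      \<subseteq> frontier (open_unit_cylinder K u)"
    using unit_cylinder_subset_closure[OF assms]
    by (auto simp: frontier_def interior_open[OF open_open_unit_cylinder])
  have "negligible (frontier (open_unit_cylinder K u))"
    using assms(2) by (intro negligible_convex_frontier convex_open_unit_cylinder)
  then show "emeasure lborel (frontier (open_unit_cylinder K u)) = 0"
    by (simp add: negligible_iff_null_sets null_sets_def)
qed simp

text \<open>A point is its component along \<open>u\<close>, of norm at most 1, plus the projection
  of a point of \<open>K\<close>, crudely of norm at most \<open>2 * R\<close>. The bound is
  independent of \<open>u\<close>, so one ball dominates all cylinders.\<close>

lemma unit_cylinder_subset_cball:
  assumes u: "norm u = 1" and K: "K \<subseteq> cball 0 R"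
  shows "unit_cylinder K u \<subseteq> cball 0 (2 * R + 1)"
proof
  fix x assume "x \<in> unit_cylinder K u"
  then obtain t where x: "0 \<le> x \<bullet> u" "x \<bullet> u \<le> 1" "x + t *\<^sub>R u \<in> K"
    by (auto simp: unit_cylinder_def)
  define k where "k = x + t *\<^sub>R u"
  have k: "norm k \<le> R" using x(3) K by (auto simp: k_def)
  have "k \<bullet> u = x \<bullet> u + t" using u by (simp add: k_def inner_add_left norm_eq_1)
  then have "x = (x \<bullet> u) *\<^sub>R u + (k - (k \<bullet> u) *\<^sub>R u)" by (simp add: k_def algebra_simps)
  also have "norm \<dots> \<le> norm ((x \<bullet> u) *\<^sub>R u) + (norm k + norm ((k \<bullet> u) *\<^sub>R u))"
    using norm_triangle_ineq norm_triangle_ineq4 by (metis add_left_mono order_trans)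
  also have "\<dots> \<le> 1 + (R + R)"
    using x k u Cauchy_Schwarz_ineq2[of k u] by (intro add_mono) auto
  finally show "x \<in> cball 0 (2 * R + 1)" by simp
qed

text \<open>The point is fixed and the direction varies: if the cylinder for \<open>u\<close> misses
  \<open>x\<close>, so do the cylinders for all nearby unit directions.\<close>

lemma closed_directions_unit_cylinder:
  assumes "compact K"
  shows "closed {v \<in> sphere 0 1. x \<in> unit_cylinder K v}"
proof -
  \<comment> \<open>The parameter \<open>t\<close> has a noncompact range. Quantifying over the
    point \<open>k\<close> of the compact set \<open>K\<close> instead allows a closed set to be
    projected along a compact factor.\<close>
  have "x \<in> unit_cylinder K v \<longleftrightarrow> 0 \<le> x \<bullet> v \<and> x \<bullet> v \<le> 1 \<and>
      (\<exists>k. k \<in> K \<and> x - (x \<bullet> v) *\<^sub>R v = k - (k \<bullet> v) *\<^sub>R v)" if "norm v = 1" for v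
  proof -
    have "v \<bullet> v = 1" using that by (simp add: norm_eq_1)
    then show ?thesis
      using mem_hyperplane_proj_image_iff[OF that, of x K]
      by (auto simp: unit_cylinder_def hyperplane_proj_def image_iff)
  qed
  then have "{v \<in> sphere 0 1. x \<in> unit_cylinder K v} = sphere 0 1 \<inter> {v. 0 \<le> x \<bullet> v} \<inter> {v. x \<bullet> v \<le> 1} \<inter>
      {v. \<exists>k. k \<in> K \<and> (k, v) \<in> {p. x - (x \<bullet> snd p) *\<^sub>R snd p = fst p - (fst p \<bullet> snd p) *\<^sub>R snd p}}"
    by auto
  also have "closed \<dots>"
    by (intro closed_Int closed_sphere closed_Collect_le closed_compact_projection assms
        closed_Collect_eq continuous_intros)
  finally show ?thesis .
qed

lemma unit_cylinder_measurable:
  assumes "norm u = 1" "compact K"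
  shows "unit_cylinder K u \<in> fmeasurable lborel"
proof -
  obtain R where "K \<subseteq> cball 0 R" using compact_imp_bounded[OF assms(2)] by (auto simp: bounded_iff subset_iff)
  then have "bounded (unit_cylinder K u)"
    by (rule bounded_subset[OF bounded_cball unit_cylinder_subset_cball[OF assms(1)]])
  then show ?thesis
    using closed_unit_cylinder[OF assms] emeasure_bounded_finite[of "unit_cylinder K u"]
    by (simp add: fmeasurable_def)
qed

text \<open>Dominated convergence for indicators of cylinders: almost every point lies in the open
  cylinder for \<open>u\<close> or outside the closed one, and either status persists for directions
  near \<open>u\<close>.\<close>

lemma continuous_on_proj_volume:
  fixes K :: "'a::euclidean_space set"
  assumes K: "compact K" "convex K" "interior K \<noteq> {}"
  shows "continuous_on (sphere 0 1) (proj_volume K)"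
proof (rule continuous_on_sequentiallyI)
  fix v :: "nat \<Rightarrow> 'a" and u
  assume v: "\<forall>n. v n \<in> sphere 0 1" and u: "u \<in> sphere 0 1" and lim: "v \<longlonglongrightarrow> u"
  obtain R where R: "K \<subseteq> cball 0 R" using compact_imp_bounded[OF K(1)] by (auto simp: bounded_iff subset_iff)
  have ae: "AE x in lborel. x \<in> unit_cylinder K u \<longrightarrow> x \<in> open_unit_cylinder K u"
    using u K by (intro AE_unit_cylinder) auto
  have "AE x in lborel. (\<lambda>n. indicator (unit_cylinder K (v n)) x :: real) \<longlonglongrightarrow> indicator (unit_cylinder K u) x"
    using ae
  proof eventually_elim
    fix x assume x: "x \<in> unit_cylinder K u \<longrightarrow> x \<in> open_unit_cylinder K u"
    show "(\<lambda>n. indicator (unit_cylinder K (v n)) x :: real) \<longlonglongrightarrow> indicator (unit_cylinder K u) x"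
    proof (cases "x \<in> unit_cylinder K u")
      case True
      then obtain t where t: "0 < x \<bullet> u" "x \<bullet> u < 1" "x + t *\<^sub>R u \<in> interior K"
        using x by (auto simp: open_unit_cylinder_def)
      have "(\<lambda>n. x \<bullet> v n) \<longlonglongrightarrow> x \<bullet> u" "(\<lambda>n. x + t *\<^sub>R v n) \<longlonglongrightarrow> x + t *\<^sub>R u"
        by (intro tendsto_intros lim)+
      then have "\<forall>\<^sub>F n in sequentially. 0 < x \<bullet> v n" "\<forall>\<^sub>F n in sequentially. x \<bullet> v n < 1"
        "\<forall>\<^sub>F n in sequentially. x + t *\<^sub>R v n \<in> interior K"
        using t by (auto intro: order_tendstoD topological_tendstoD[OF _ open_interior])
      then have "\<forall>\<^sub>F n in sequentially. x \<in> unit_cylinder K (v n)"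
      proof eventually_elim
        case (elim n)
        then have "x \<in> open_unit_cylinder K (v n)" by (auto simp: open_unit_cylinder_def)
        then show ?case using open_unit_cylinder_subset by blast
      qed
      then show ?thesis using True by (intro tendsto_eventually) (auto elim: eventually_mono)
    next
      case False
      then have "u \<in> - {v \<in> sphere 0 1. x \<in> unit_cylinder K v}" by simp
      moreover have "open (- {v \<in> sphere 0 1. x \<in> unit_cylinder K v})"
        using closed_directions_unit_cylinder[OF K(1)] by (simp add: open_Compl)
      ultimately have "\<forall>\<^sub>F n in sequentially. v n \<in> - {v \<in> sphere 0 1. x \<in> unit_cylinder K v}"
        using lim by (intro topological_tendstoD)
      then have "\<forall>\<^sub>F n in sequentially. x \<notin> unit_cylinder K (v n)"
        using v by (auto elim!: eventually_mono)
      then show ?thesis using False by (intro tendsto_eventually) (auto elim: eventually_mono)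
    qed
  qed
  moreover have meas: "unit_cylinder K w \<in> sets borel" if "w \<in> sphere 0 1" for w
    using closed_unit_cylinder[of w K] that K(1) by simp
  moreover have "norm (indicator (unit_cylinder K (v n)) x :: real) \<le> indicator (cball 0 (2 * R + 1)) x" for n x
    using unit_cylinder_subset_cball[OF _ R, of "v n"] v by (auto simp: indicator_def)
  moreover have "integrable lborel (indicator (cball (0::'a) (2 * R + 1)) :: 'a \<Rightarrow> real)"
    using emeasure_lborel_cball_finite by (intro integrable_real_indicator) auto
  ultimately have "(\<lambda>n. integral\<^sup>L lborel (indicator (unit_cylinder K (v n)) :: 'a \<Rightarrow> real)) \<longlonglongrightarrow>
      integral\<^sup>L lborel (indicator (unit_cylinder K u))"
    using u v by (intro integral_dominated_convergence[where w = "indicator (cball 0 (2 * R + 1))"]) auto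
  then show "(\<lambda>n. proj_volume K (v n)) \<longlonglongrightarrow> proj_volume K u"
    using u v K(1) by (simp add: proj_volume_eq_measure_cylinder)
qed

text \<open>The cylinder contains a nonempty open set. Positivity is what keeps the quotients in the
  constant continuous.\<close>

lemma proj_volume_pos:
  assumes u: "norm u = 1" and K: "compact K" "convex K" "interior K \<noteq> {}"
  shows "proj_volume K u > 0"
proof (rule ccontr)
  assume "\<not> proj_volume K u > 0"
  then have "measure lborel (unit_cylinder K u) = 0"
    using proj_volume_eq_measure_cylinder[OF u K(1)] measure_nonneg[of lborel "unit_cylinder K u"] by simp
  then have "unit_cylinder K u \<in> null_sets lborel"
    using unit_cylinder_measurable[OF u K(1)]
    by (auto simp: null_sets_def fmeasurable_def emeasure_eq_ennreal_measure)
  then have "negligible (unit_cylinder K u)"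
    by (simp add: negligible_iff_null_sets null_sets_completionI)
  then have "negligible (open_unit_cylinder K u)"
    using open_unit_cylinder_subset by (rule negligible_subset)
  moreover have "open_unit_cylinder K u \<noteq> {}" using centre_in_open_unit_cylinder[OF u] K(3) by blast
  ultimately show False using open_not_negligible open_open_unit_cylinder by blast
qed

section \<open>Existence of an optimal frame\<close>

text \<open>A count of dimensions replaces the spanning condition.\<close>

lemma frameI:
  assumes "pairwise orthogonal B" "\<And>b. b \<in> B \<Longrightarrow> norm b = 1" "card B = DIM('a)"
  shows "frame (B :: 'a::euclidean_space set)"
proof -
  have "independent B" using assms(1) assms(2)[of 0] by (intro pairwise_orthogonal_independent) auto
  then have "dim B = DIM('a)" using assms(3) by (simp add: dim_eq_card_independent)
  then show ?thesis using assms by (simp add: orthonormal_basis_of_def dim_eq_full)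
qed

text \<open>
  Enumerating frames by rows of matrices puts them into a Euclidean space, where compactness
  yields the maximum in \<^const>\<open>LW_constant\<close>.
\<close>
definition orthonormal_rows :: "(real ^ 'n ^ 'n) set" where
  "orthonormal_rows = {A. \<forall>i j. A $ i \<bullet> A $ j = (if i = j then 1 else 0)}"

lemma norm_orthonormal_rows: "A \<in> orthonormal_rows \<Longrightarrow> norm (A $ i) = 1"
  by (simp add: orthonormal_rows_def norm_eq_1)

lemma inj_orthonormal_rows: "A \<in> orthonormal_rows \<Longrightarrow> inj (($) A)"
proof (rule injI)
  fix i j assume "A \<in> orthonormal_rows" and eq: "A $ i = A $ j"
  then have "A $ i \<bullet> A $ j = (if i = j then 1 else 0)" "A $ j \<bullet> A $ j = 1"
    unfolding orthonormal_rows_def mem_Collect_eq by metis+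
  then show "i = j" using eq by (simp split: if_splits)
qed

lemma frame_orthonormal_rows:
  assumes "A \<in> orthonormal_rows"
  shows "frame (range (($) A))"
proof (rule frameI)
  show "pairwise orthogonal (range (($) A))"
    using assms by (auto simp: pairwise_def orthogonal_def orthonormal_rows_def)
  show "card (range (($) A)) = DIM(real ^ 'a)"
    using inj_orthonormal_rows[OF assms] by (simp add: card_image)
qed (use norm_orthonormal_rows[OF assms] in auto)

text \<open>A frame has as many elements as the index type, so any bijection supplies the rows;
  hence the matrices miss no frame.\<close>

lemma frame_eq_orthonormal_rows:
  assumes F: "frame (F :: (real ^ 'n) set)"
  obtains A where "A \<in> orthonormal_rows" "F = range (($) A)"
proof -
  have "finite F" "card F = CARD('n)"
    using orthonormal_basis_of_finite[OF F] orthonormal_basis_of_card[OF F] by simp_all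
  then obtain h :: "'n \<Rightarrow> real ^ 'n" where h: "bij_betw h UNIV F"
    by (metis finite_same_card_bij finite_class.finite_UNIV)
  let ?A = "\<chi> i. h i"
  have "?A \<in> orthonormal_rows"
    using orthonormal_basis_of_inner[OF F] h
    by (auto simp: orthonormal_rows_def bij_betw_def inj_on_def)
  moreover have "F = range (($) ?A)" using h by (auto simp: bij_betw_def)
  ultimately show ?thesis by (rule that)
qed

lemma compact_orthonormal_rows: "compact (orthonormal_rows :: (real ^ 'n ^ 'n) set)"
  unfolding compact_eq_bounded_closed
proof
  \<comment> \<open>A crude bound: the norm is at most the sum of the row norms, each of which is
    1.\<close>
  have "norm A \<le> CARD('n)" if "A \<in> orthonormal_rows" for A :: "real ^ 'n ^ 'n"
    using L2_set_le_sum[of UNIV "\<lambda>i. norm (A $ i)"] norm_orthonormal_rows[OF that]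
    by (simp add: norm_vec_def)
  then show "bounded (orthonormal_rows :: (real ^ 'n ^ 'n) set)" by (auto simp: bounded_iff subset_iff)
  show "closed (orthonormal_rows :: (real ^ 'n ^ 'n) set)"
    unfolding orthonormal_rows_def by (intro closed_Collect_all closed_Collect_eq continuous_intros)
qed

text \<open>\<open>GREATEST\<close> needs an attained maximum. Continuity on a compact set gives a
  maximiser \<open>A0\<close>, and its value is then identified with the constant.\<close>

lemma LW_constant_ge:
  fixes K :: "(real ^ 'n) set"
  assumes K: "compact K" "convex K" "interior K \<noteq> {}" and A: "A \<in> orthonormal_rows"
  shows "measure lebesgue K ^ (CARD('n) - 1) / (\<Prod>i\<in>UNIV. proj_volume K (A $ i)) \<le> LW_constant K"
proof -
  let ?v = "\<lambda>A. measure lebesgue K ^ (CARD('n) - 1) / (\<Prod>i\<in>UNIV. proj_volume K (A $ i))"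
  have "continuous_on orthonormal_rows (\<lambda>A. proj_volume K (A $ i))" for i
    by (rule continuous_on_compose2[OF continuous_on_proj_volume[OF K]])
      (auto intro!: continuous_intros simp: norm_orthonormal_rows)
  moreover have "proj_volume K (A $ i) \<noteq> 0" if "A \<in> orthonormal_rows" for A i
    using proj_volume_pos[OF norm_orthonormal_rows[OF that] K] by (rule less_imp_neq[THEN not_sym])
  ultimately have "continuous_on orthonormal_rows ?v"
    by (intro continuous_intros) simp_all
  then obtain A0 where A0: "A0 \<in> orthonormal_rows" "\<And>A. A \<in> orthonormal_rows \<Longrightarrow> ?v A \<le> ?v A0"
    using continuous_attains_sup[OF compact_orthonormal_rows] A by blast
  \<comment> \<open>Distinct indices have distinct rows, so the product over the set has one factor
    per index.\<close>
  have rows: "(\<Prod>u\<in>range (($) A). proj_volume K u) = (\<Prod>i\<in>UNIV. proj_volume K (A $ i))"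
    if "A \<in> orthonormal_rows" for A
    using inj_orthonormal_rows[OF that] by (simp add: prod.reindex)
  have "LW_constant K = ?v A0" unfolding LW_constant_def
  proof (rule Greatest_equality)
    show "\<exists>F. frame F \<and> ?v A0 = measure lebesgue K ^ (DIM(real ^ 'n) - 1) / (\<Prod>u\<in>F. proj_volume K u)"
      using frame_orthonormal_rows[OF A0(1)] rows[OF A0(1)] by (intro exI[of _ "range (($) A0)"]) simp
    fix r assume "\<exists>F. frame F \<and> r = measure lebesgue K ^ (DIM(real ^ 'n) - 1) / (\<Prod>u\<in>F. proj_volume K u)"
    then obtain F where F: "frame F" "r = measure lebesgue K ^ (DIM(real ^ 'n) - 1) / (\<Prod>u\<in>F. proj_volume K u)"
      by blast
    obtain A where "A \<in> orthonormal_rows" "F = range (($) A)" using frame_eq_orthonormal_rows[OF F(1)] .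
    then show "r \<le> ?v A0" using F(2) A0(2)[of A] rows[of A] by simp
  qed
  then show ?thesis using A0(2)[OF A] by simp
qed

section \<open>Volumes of weighted crosspolytopes\<close>

lemma power_linear_has_derivative:
  fixes a k :: real
  assumes "a \<noteq> 0" "k \<noteq> 0"
  shows "((\<lambda>y. (d + a * y) ^ Suc n / (a * Suc n * k)) has_real_derivative (d + a * y) ^ n / k) (at y within S)"
proof -
  have "((\<lambda>y. (d + a * y) ^ Suc n / (a * Suc n * k)) has_real_derivative
      (Suc n * (d + a * y) ^ n * a) / (a * Suc n * k)) (at y within S)"
    by (rule DERIV_cdivide) (rule derivative_eq_intros refl | simp)+
  then show ?thesis using assms by simp
qed

text \<open>Induction by slicing: fixing coordinate \<open>b\<close> at \<open>y\<close> leaves a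
  weighted crosspolytope of size \<open>t - c b * \<bar>y\<bar>\<close>, whose volume is integrated
  over \<open>y\<close>. The size \<open>t\<close> must therefore vary in the induction.\<close>

lemma emeasure_weighted_crosspolytope:
  fixes c :: "'a \<Rightarrow> real"
  assumes "finite A" "\<And>a. a \<in> A \<Longrightarrow> c a > 0" "t \<ge> 0"
  shows "emeasure (\<Pi>\<^sub>M a\<in>A. lborel) ({f. (\<Sum>a\<in>A. c a * \<bar>f a\<bar>) \<le> t} \<inter> space (\<Pi>\<^sub>M a\<in>A. lborel))
    = ennreal ((2 * t) ^ card A / (fact (card A) * prod c A))"
  using assms
proof (induction A arbitrary: t rule: finite_induct)
  case empty
  then show ?case by (simp add: PiM_empty)
next
  case (insert b A t)
  let ?M = "\<lambda>A. \<Pi>\<^sub>M a\<in>A. lborel :: real measure"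
  define S where "S A t = {f. (\<Sum>a\<in>A. c a * \<bar>f a\<bar>) \<le> t} \<inter> space (?M A)" for A and t :: real
  define n where "n = card A"
  define k where "k = fact n * prod c A"
  \<comment> \<open>The slice at \<open>y\<close> is nonempty exactly for \<open>y\<close> in
    \<open>{-s..s}\<close>.\<close>
  define s where "s = t / c b"
  have cb: "c b > 0" and k: "k > 0"
    using insert.prems by (auto simp: k_def intro!: mult_pos_pos prod_pos)
  then have s: "s \<ge> 0" using insert.prems(2) by (simp add: s_def)
  have ts: "t = c b * s" using cb by (simp add: s_def)
  have meas[measurable]: "S A t \<in> sets (?M A)" if "finite A" for A t
    unfolding S_def using that by measurable
  have step: "indicator (S (insert b A) t) (f(b := y)) =
      (indicator {-s..s} y * indicator (S A (t - c b * \<bar>y\<bar>)) f :: ennreal)" if f: "f \<in> space (?M A)" for f y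
  proof -
    have "f(b := y) \<in> space (?M (insert b A))" using f by (auto simp: space_PiM PiE_def extensional_def)
    moreover have "(\<Sum>a\<in>insert b A. c a * \<bar>(f(b := y)) a\<bar>) = c b * \<bar>y\<bar> + (\<Sum>a\<in>A. c a * \<bar>f a\<bar>)"
      using insert.hyps by (auto intro!: sum.cong)
    moreover have "(\<Sum>a\<in>A. c a * \<bar>f a\<bar>) \<ge> 0"
      using insert.prems by (intro sum_nonneg) (simp add: less_imp_le)
    moreover have "c b * \<bar>y\<bar> \<le> t \<longleftrightarrow> y \<in> {-s..s}"
      unfolding ts using cb by (auto simp: abs_le_iff)
    ultimately show ?thesis using f by (auto simp: indicator_def S_def)
  qed
  have FTC: "((\<lambda>y. (2 * t + a * y) ^ n / k) has_integral
      ((2 * t + a * v) ^ Suc n / (a * Suc n * k) - (2 * t + a * u) ^ Suc n / (a * Suc n * k))) {u..v}"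
    if "u \<le> v" "a \<noteq> 0" for a u v
    using that power_linear_has_derivative[of a k "2 * t" n] k
    by (intro fundamental_theorem_of_calculus)
      (simp_all add: has_real_derivative_iff_has_vector_derivative)
  \<comment> \<open>On each half of the interval the base is linear in \<open>y\<close>, and the
    antiderivative vanishes at the outer endpoint because \<open>t = c b * s\<close>.\<close>
  have I1: "((\<lambda>y. (2 * (t - c b * \<bar>y\<bar>)) ^ n / k) has_integral
      (2 * t) ^ Suc n / (2 * (c b * Suc n * k))) {0..s}"
  proof (rule has_integral_eq)
    show "((\<lambda>y. (2 * t + (- 2 * c b) * y) ^ n / k) has_integral
      (2 * t) ^ Suc n / (2 * (c b * Suc n * k))) {0..s}"
      using FTC[of 0 s "- 2 * c b"] s cb by (simp add: ts)
  qed (simp add: algebra_simps)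
  have I2: "((\<lambda>y. (2 * (t - c b * \<bar>y\<bar>)) ^ n / k) has_integral
      (2 * t) ^ Suc n / (2 * (c b * Suc n * k))) {-s..0}"
  proof (rule has_integral_eq)
    show "((\<lambda>y. (2 * t + (2 * c b) * y) ^ n / k) has_integral
      (2 * t) ^ Suc n / (2 * (c b * Suc n * k))) {-s..0}"
      using FTC[of "-s" 0 "2 * c b"] s cb by (simp add: ts)
  qed (simp add: algebra_simps)
  have I: "((\<lambda>y. (2 * (t - c b * \<bar>y\<bar>)) ^ n / k) has_integral (2 * t) ^ Suc n / (c b * Suc n * k)) {-s..s}"
  proof -
    have "x / (2 * m) + x / (2 * m) = x / m" for x m :: real by (simp add: field_simps)
    from has_integral_combine[OF _ _ I2 I1, unfolded this] s show ?thesis by simp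
  qed
  have "emeasure (?M (insert b A)) (S (insert b A) t) =
      (\<integral>\<^sup>+f. indicator (S (insert b A) t) f \<partial>?M (insert b A))"
    by (rule nn_integral_indicator[symmetric]) (rule meas, simp add: insert.hyps)
  also have "\<dots> = (\<integral>\<^sup>+y. (\<integral>\<^sup>+f. indicator (S (insert b A) t) (f(b := y)) \<partial>?M A) \<partial>lborel)"
    by (rule lborel_product.product_nn_integral_insert_rev[OF insert.hyps
        borel_measurable_indicator[OF meas]]) (simp add: insert.hyps)
  also have "\<dots> = (\<integral>\<^sup>+y. (\<integral>\<^sup>+f. indicator {-s..s} y * indicator (S A (t - c b * \<bar>y\<bar>)) f \<partial>?M A) \<partial>lborel)"
    by (intro nn_integral_cong step)
  also have "\<dots> = (\<integral>\<^sup>+y. indicator {-s..s} y * emeasure (?M A) (S A (t - c b * \<bar>y\<bar>)) \<partial>lborel)"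
    by (simp only: nn_integral_cmult[OF borel_measurable_indicator[OF meas[OF insert.hyps(1)]]]
        nn_integral_indicator[OF meas[OF insert.hyps(1)]])
  also have "\<dots> = (\<integral>\<^sup>+y. ennreal (indicator {-s..s} y * ((2 * (t - c b * \<bar>y\<bar>)) ^ n / k)) \<partial>lborel)"
  proof (rule nn_integral_cong)
    fix y
    show "indicator {-s..s} y * emeasure (?M A) (S A (t - c b * \<bar>y\<bar>)) =
      ennreal (indicator {-s..s} y * ((2 * (t - c b * \<bar>y\<bar>)) ^ n / k))"
    proof (cases "y \<in> {-s..s}")
      case True
      then have "c b * \<bar>y\<bar> \<le> t" unfolding ts using cb by (auto simp: abs_le_iff)
      then show ?thesis using insert.IH[of "t - c b * \<bar>y\<bar>"] insert.prems True by (simp add: n_def k_def S_def)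
    qed simp
  qed
  also have "\<dots> = ennreal ((2 * t) ^ Suc n / (c b * Suc n * k))"
  proof (rule nn_integral_has_integral_lebesgue[OF _ I])
    fix y assume "y \<in> {-s..s}"
    then have "c b * \<bar>y\<bar> \<le> t" unfolding ts using cb by (auto simp: abs_le_iff)
    then show "0 \<le> (2 * (t - c b * \<bar>y\<bar>)) ^ n / k" using k by simp
  qed
  also have "c b * Suc n * k = fact (card (insert b A)) * prod c (insert b A)"
    using insert.hyps by (simp add: k_def n_def)
  also have "Suc n = card (insert b A)" using insert.hyps by (simp add: n_def)
  finally show ?case by (simp only: S_def)
qed

text \<open>Projecting along \<open>u\<close> does not change the coordinates in \<open>B\<close>,
  so the projection lies in a weighted crosspolytope of known volume. An upper bound suffices, as
  projection volumes stand in the denominator.\<close>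

lemma proj_volume_le:
  fixes K :: "'a::euclidean_space set"
  assumes K: "compact K" and uB: "frame (insert u B)" "u \<notin> B"
    and c: "\<And>b. b \<in> B \<Longrightarrow> c b > 0"
    and le: "\<And>x. x \<in> K \<Longrightarrow> (\<Sum>b\<in>B. c b * \<bar>x \<bullet> b\<bar>) \<le> 1"
  shows "proj_volume K u \<le> 2 ^ (DIM('a) - 1) / (fact (DIM('a) - 1) * prod c B)"
proof -
  have fin: "finite B" using orthonormal_basis_of_finite[OF uB(1)] by simp
  have card: "card B = DIM('a) - 1" using orthonormal_basis_of_card[OF uB(1)] uB(2) fin by simp
  have u: "norm u = 1" using uB(1) by (simp add: orthonormal_basis_of_def)
  have perp: "u \<bullet> b = 0" if "b \<in> B" for b
    using orthonormal_basis_of_inner[OF uB(1), of u b] that uB(2) by auto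
  have "x \<in> span B" if "u \<bullet> x = 0" for x
  proof -
    have "(\<Sum>b\<in>insert u B. (x \<bullet> b) *\<^sub>R b) = x" by (rule orthonormal_basis_of_expand[OF uB(1)]) simp
    then have "(\<Sum>b\<in>B. (x \<bullet> b) *\<^sub>R b) = x" using fin uB(2) that by (simp add: inner_commute)
    moreover have "(\<Sum>b\<in>B. (x \<bullet> b) *\<^sub>R b) \<in> span B" by (intro span_sum span_scale span_base)
    ultimately show ?thesis by simp
  qed
  moreover have "span B \<subseteq> {x. u \<bullet> x = 0}"
    using perp by (intro span_minimal subspace_hyperplane) auto
  ultimately have B: "orthonormal_basis_of {x. u \<bullet> x = 0} B"
    using uB(1) unfolding orthonormal_basis_of_def by (auto simp: pairwise_insert)
  let ?M = "\<Pi>\<^sub>M b\<in>B. lborel :: real measure" and ?S = "\<lambda>f. \<Sum>b\<in>B. f b *\<^sub>R b"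
  have "compact (hyperplane_proj u ` K)"
    using K by (intro compact_continuous_image continuous_on_hyperplane_proj)
  then have P[measurable]: "hyperplane_proj u ` K \<in> sets borel" by (simp add: compact_imp_closed)
  have "emeasure lborel (unit_cylinder K u) = emeasure ?M (?S -` (hyperplane_proj u ` K) \<inter> space ?M)"
    using fin unfolding emeasure_hyperplane_proj[OF u B K, symmetric] by (subst emeasure_distr) auto
  also have "\<dots> \<le> emeasure ?M ({f. (\<Sum>b\<in>B. c b * \<bar>f b\<bar>) \<le> 1} \<inter> space ?M)"
  proof (rule emeasure_mono)
    show "?S -` (hyperplane_proj u ` K) \<inter> space ?M \<subseteq> {f. (\<Sum>b\<in>B. c b * \<bar>f b\<bar>) \<le> 1} \<inter> space ?M"
    proof clarsimp
      fix f x assume x: "x \<in> K" and f: "?S f = hyperplane_proj u x"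
      have "f b = x \<bullet> b" if b: "b \<in> B" for b
        using orthonormal_basis_of_inner_sum[OF B b, of f] perp[OF b]
        by (simp add: f hyperplane_proj_def inner_diff_left)
      then show "(\<Sum>b\<in>B. c b * \<bar>f b\<bar>) \<le> 1" using le[OF x] by simp
    qed
    show "{f. (\<Sum>b\<in>B. c b * \<bar>f b\<bar>) \<le> 1} \<inter> space ?M \<in> sets ?M" using fin by measurable
  qed
  also have "\<dots> = ennreal (2 ^ (DIM('a) - 1) / (fact (DIM('a) - 1) * prod c B))"
    using emeasure_weighted_crosspolytope[OF fin c, where t = 1] by (simp add: card)
  finally show ?thesis
    using prod_nonneg[of B c] c
    by (simp add: proj_volume_eq_measure_cylinder[OF u K] measure_def enn2real_leI less_imp_le)
qed

section \<open>The crosspolytope\<close>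

lemma compact_crosspolytope: "compact (crosspolytope :: (real ^ 'n) set)"
  unfolding crosspolytope_def by (intro finite_imp_compact_convex_hull) auto

lemma convex_crosspolytope: "convex (crosspolytope :: (real ^ 'n) set)"
  by (simp add: crosspolytope_def)

text \<open>The unit ball of the sum norm is convex and contains the vertices, hence their
  hull.\<close>

lemma crosspolytope_l1_le:
  fixes x :: "real ^ 'n"
  assumes "x \<in> crosspolytope"
  shows "(\<Sum>i\<in>UNIV. \<bar>x $ i\<bar>) \<le> 1"
proof -
  have "convex {x :: real ^ 'n. (\<Sum>i\<in>UNIV. \<bar>x $ i\<bar>) \<le> 1}"
  proof (rule convexI, clarify)
    fix x y :: "real ^ 'n" and a b :: real
    assume a: "a \<ge> 0" "b \<ge> 0" "a + b = 1" and x: "(\<Sum>i\<in>UNIV. \<bar>x $ i\<bar>) \<le> 1" and y: "(\<Sum>i\<in>UNIV. \<bar>y $ i\<bar>) \<le> 1"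
    have "(\<Sum>i\<in>UNIV. \<bar>(a *\<^sub>R x + b *\<^sub>R y) $ i\<bar>) \<le> (\<Sum>i\<in>UNIV. a * \<bar>x $ i\<bar> + b * \<bar>y $ i\<bar>)"
    proof (rule sum_mono)
      fix i
      show "\<bar>(a *\<^sub>R x + b *\<^sub>R y) $ i\<bar> \<le> a * \<bar>x $ i\<bar> + b * \<bar>y $ i\<bar>"
        using abs_triangle_ineq[of "a * x $ i" "b * y $ i"] a by (simp add: abs_mult)
    qed
    also have "\<dots> = a * (\<Sum>i\<in>UNIV. \<bar>x $ i\<bar>) + b * (\<Sum>i\<in>UNIV. \<bar>y $ i\<bar>)"
      by (simp add: sum.distrib sum_distrib_left)
    also have "\<dots> \<le> a * 1 + b * 1" using a x y by (intro add_mono mult_left_mono)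
    finally show "(\<Sum>i\<in>UNIV. \<bar>(a *\<^sub>R x + b *\<^sub>R y) $ i\<bar>) \<le> 1" using a by simp
  qed
  moreover have "(\<Sum>i\<in>UNIV. \<bar>(axis j 1 :: real ^ 'n) $ i\<bar>) = 1" for j
    by (simp add: axis_def if_distrib cong: if_cong)
  then have "range (\<lambda>i. axis i 1) \<union> range (\<lambda>i. - axis i 1) \<subseteq> {x :: real ^ 'n. (\<Sum>i\<in>UNIV. \<bar>x $ i\<bar>) \<le> 1}"
    by auto
  ultimately show ?thesis using assms hull_minimal unfolding crosspolytope_def by blast
qed

text \<open>A nonzero \<open>x\<close> of sum norm \<open>s\<close> is \<open>s\<close> times a
  convex combination of signed axes with weights \<open>\<bar>x $ i\<bar> / s\<close>. Since
  \<open>s \<le> 1\<close>, mixing with the origin absorbs the factor \<open>s\<close>.\<close>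

lemma l1_le_crosspolytope:
  fixes x :: "real ^ 'n"
  assumes x: "(\<Sum>i\<in>UNIV. \<bar>x $ i\<bar>) \<le> 1"
  shows "x \<in> crosspolytope"
proof -
  define s where "s = (\<Sum>i\<in>UNIV. \<bar>x $ i\<bar>)"
  have e: "axis i 1 \<in> crosspolytope" "- axis i 1 \<in> crosspolytope" for i :: 'n
    unfolding crosspolytope_def by (auto intro!: hull_inc)
  have "(1/2) *\<^sub>R axis i 1 + (1/2) *\<^sub>R (- axis i 1) \<in> crosspolytope" for i :: 'n
    by (rule convexD[OF convex_crosspolytope e]) simp_all
  then have zero: "(0 :: real ^ 'n) \<in> crosspolytope" by simp
  show ?thesis
  proof (cases "s = 0")
    case True
    then have "x = 0" by (simp add: s_def sum_nonneg_eq_0_iff vec_eq_iff)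
    then show ?thesis using zero by simp
  next
    case False
    moreover have "s \<ge> 0" by (simp add: s_def sum_nonneg)
    ultimately have s: "s > 0" by simp
    have "(\<Sum>i\<in>UNIV. (\<bar>x $ i\<bar> / s) *\<^sub>R (if x $ i \<ge> 0 then axis i 1 else - axis i 1)) \<in> crosspolytope"
      using s e by (intro convex_sum convex_crosspolytope)
        (auto simp: s_def sum_divide_distrib[symmetric])
    from convexD[OF convex_crosspolytope this zero, of s "1 - s"] s x
    have "s *\<^sub>R (\<Sum>i\<in>UNIV. (\<bar>x $ i\<bar> / s) *\<^sub>R (if x $ i \<ge> 0 then axis i 1 else - axis i 1)) \<in> crosspolytope"
      by (simp add: s_def)
    also have "s *\<^sub>R (\<Sum>i\<in>UNIV. (\<bar>x $ i\<bar> / s) *\<^sub>R (if x $ i \<ge> 0 then axis i 1 else - axis i 1 :: real ^ 'n))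
        = (\<Sum>i\<in>UNIV. (x $ i) *\<^sub>R axis i 1)"
      unfolding scaleR_sum_right using s by (intro sum.cong) auto
    also have "\<dots> = x"
      using basis_expansion[of x] by (simp add: scalar_mult_eq_scaleR)
    finally show ?thesis .
  qed
qed

lemma frame_Basis: "frame Basis"
  by (rule frameI) (auto simp: pairwise_def orthogonal_def inner_not_same_Basis)

text \<open>In standard coordinates this is the weighted crosspolytope with all weights and the size
  equal to 1.\<close>

lemma measure_crosspolytope:
  "measure lebesgue (crosspolytope :: (real ^ 'n) set) = 2 ^ CARD('n) / fact CARD('n)"
proof -
  have l1: "(\<Sum>b\<in>Basis. \<bar>x \<bullet> b\<bar>) = (\<Sum>i\<in>UNIV. \<bar>x $ i\<bar>)" for x :: "real ^ 'n"
  proof -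
    have Basis: "(Basis :: (real ^ 'n) set) = range (\<lambda>i. axis i 1)" by (auto simp: Basis_vec_def)
    have inj: "inj (\<lambda>i. axis i 1 :: real ^ 'n)" by (auto simp: inj_def axis_eq_axis)
    show ?thesis unfolding Basis by (simp add: sum.reindex[OF inj] inner_axis)
  qed
  have C: "crosspolytope = {x :: real ^ 'n. (\<Sum>b\<in>Basis. \<bar>x \<bullet> b\<bar>) \<le> 1}"
    using crosspolytope_l1_le l1_le_crosspolytope by (auto simp: l1)
  have meas: "(crosspolytope :: (real ^ 'n) set) \<in> sets borel"
    using compact_crosspolytope compact_imp_closed by (intro borel_closed) blast
  have "emeasure lborel (crosspolytope :: (real ^ 'n) set) =
      emeasure (distr (\<Pi>\<^sub>M b\<in>Basis. lborel) borel (\<lambda>f. \<Sum>b\<in>Basis. f b *\<^sub>R b)) (crosspolytope :: (real ^ 'n) set)"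
    by (simp only: lborel_orthonormal_basis[OF frame_Basis])
  also have "\<dots> = emeasure (\<Pi>\<^sub>M b\<in>Basis. lborel)
      ({f. (\<Sum>b\<in>(Basis :: (real ^ 'n) set). 1 * \<bar>f b\<bar>) \<le> (1::real)} \<inter> space (\<Pi>\<^sub>M b\<in>Basis. lborel))"
    using meas by (subst emeasure_distr) (auto simp: C)
  also have "\<dots> = ennreal (2 ^ CARD('n) / fact CARD('n))"
    by (subst emeasure_weighted_crosspolytope) simp_all
  finally have "measure lborel (crosspolytope :: (real ^ 'n) set) = 2 ^ CARD('n) / fact CARD('n)"
    by (simp add: measure_def)
  then show ?thesis using meas by (simp add: measure_completion)
qed

text \<open>A convex set with empty interior is negligible, whereas the volume is positive.\<close>

lemma interior_crosspolytope: "interior (crosspolytope :: (real ^ 'n) set) \<noteq> {}"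
proof
  assume "interior (crosspolytope :: (real ^ 'n) set) = {}"
  then have "negligible (crosspolytope :: (real ^ 'n) set)"
    using negligible_convex_interior[OF convex_crosspolytope] by blast
  from negligible_imp_measure0[OF this] show False by (simp add: measure_crosspolytope)
qed

section \<open>Projections along axes and diagonals\<close>

text \<open>Dropping one coordinate does not increase the sum norm, so weight 1 serves for every
  remaining axis.\<close>

lemma proj_volume_crosspolytope_axis:
  "proj_volume crosspolytope (axis i 1 :: real ^ 'n) \<le> 2 ^ (CARD('n) - 1) / fact (CARD('n) - 1)"
proof -
  let ?B = "(\<lambda>j. axis j 1 :: real ^ 'n) ` (- {i})"
  have inj: "inj_on (\<lambda>j. axis j 1 :: real ^ 'n) A" for A by (auto simp: inj_on_def axis_eq_axis)
  have "insert (axis i 1) ?B = Basis" by (auto simp: Basis_vec_def)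
  then have "frame (insert (axis i 1) ?B)" using frame_Basis by metis
  moreover have "axis i 1 \<notin> ?B" by (auto simp: axis_eq_axis)
  moreover have "(\<Sum>b\<in>?B. 1 * \<bar>x \<bullet> b\<bar>) \<le> 1" if "x \<in> crosspolytope" for x :: "real ^ 'n"
  proof -
    have "(\<Sum>b\<in>?B. 1 * \<bar>x \<bullet> b\<bar>) = (\<Sum>j\<in>-{i}. \<bar>x $ j\<bar>)" by (simp add: sum.reindex[OF inj] inner_axis)
    also have "\<dots> \<le> (\<Sum>j\<in>UNIV. \<bar>x $ j\<bar>)" by (intro sum_mono2) auto
    also have "\<dots> \<le> 1" using that by (rule crosspolytope_l1_le)
    finally show ?thesis .
  qed
  ultimately show ?thesis
    using proj_volume_le[OF compact_crosspolytope, of "axis i 1" ?B "\<lambda>_. 1"] by simp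
qed

text \<open>The unit vector \<open>w\<close> orthogonal to the diagonal in the plane of axes
  \<open>i\<close> and \<open>j\<close> satisfies \<open>sqrt 2 * \<bar>x \<bullet> w\<bar> \<le>
  \<bar>x $ i\<bar> + \<bar>x $ j\<bar>\<close>. It can thus carry weight \<open>sqrt 2\<close>,
  which is the factor gained over an axis direction.\<close>

lemma proj_volume_crosspolytope_diagonal:
  fixes i j :: "'n::finite"
  assumes ij: "i \<noteq> j" and s: "s = 1 \<or> s = - 1"
  shows "proj_volume crosspolytope ((1 / sqrt 2) *\<^sub>R (s *\<^sub>R axis i 1 + axis j 1) :: real ^ 'n)
    \<le> 2 ^ (CARD('n) - 1) / fact (CARD('n) - 1) / sqrt 2"
proof -
  define u :: "real ^ 'n" where "u = (1 / sqrt 2) *\<^sub>R (s *\<^sub>R axis i 1 + axis j 1)"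
  define w :: "real ^ 'n" where "w = (1 / sqrt 2) *\<^sub>R (axis i 1 - s *\<^sub>R axis j 1)"
  define E where "E = (\<lambda>k. axis k 1 :: real ^ 'n) ` (- {i, j})"
  have inj: "inj_on (\<lambda>j. axis j 1 :: real ^ 'n) A" for A by (auto simp: inj_on_def axis_eq_axis)
  have [simp]: "finite E" by (simp add: E_def)
  have ss: "s * s = 1" using s by auto
  have axis: "(axis k 1 :: real ^ 'n) \<bullet> axis l 1 = (if k = l then 1 else 0)" for k l
    by (simp add: inner_axis_axis)
  have uu: "u \<bullet> u = 1" and ww: "w \<bullet> w = 1" and uw: "u \<bullet> w = 0"
    using ij ss by (simp_all add: u_def w_def inner_simps axis algebra_simps)
  have ue: "u \<bullet> e = 0" "w \<bullet> e = 0" if "e \<in> E" for e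
    using that by (auto simp: E_def u_def w_def inner_simps axis split: if_splits)
  have ee: "e \<bullet> e = 1" if "e \<in> E" for e using that by (auto simp: E_def axis)
  have ee': "e \<bullet> f = 0" if "e \<in> E" "f \<in> E" "e \<noteq> f" for e f using that by (auto simp: E_def axis split: if_splits)
  have notin: "u \<notin> insert w E" "w \<notin> E"
    using uu ww uw ue by force+
  have card: "card E = CARD('n) - 2" using ij by (simp add: E_def card_image[OF inj] Compl_eq_Diff_UNIV card_Diff_subset)
  \<comment> \<open>This keeps the natural subtraction \<open>CARD('n) - 2\<close> from truncating
    when the frame is counted.\<close>
  have "card {i, j} \<le> CARD('n)" by (rule card_mono) auto
  then have n: "CARD('n) \<ge> 2" using ij by simp
  have frame: "frame (insert u (insert w E))"
  proof (rule frameI)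
    show "card (insert u (insert w E)) = DIM(real ^ 'n)" using notin card n by simp
    show "pairwise orthogonal (insert u (insert w E))"
      using uw ue ee' by (auto simp: pairwise_insert orthogonal_def inner_commute pairwise_def)
  qed (use uu ww ee in \<open>auto simp only: norm_eq_1\<close>)
  let ?c = "\<lambda>b. if b = w then sqrt 2 else 1"
  have le: "(\<Sum>b\<in>insert w E. ?c b * \<bar>x \<bullet> b\<bar>) \<le> 1" if x: "x \<in> crosspolytope" for x
  proof -
    have "sqrt 2 * (x \<bullet> w) = x $ i - s * x $ j"
      by (simp add: w_def inner_simps inner_axis)
    then have "sqrt 2 * \<bar>x \<bullet> w\<bar> = \<bar>x $ i - s * x $ j\<bar>" using abs_mult[of "sqrt 2" "x \<bullet> w"] by simp
    also have "\<dots> \<le> \<bar>x $ i\<bar> + \<bar>x $ j\<bar>" using s by auto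
    finally have w: "sqrt 2 * \<bar>x \<bullet> w\<bar> \<le> \<bar>x $ i\<bar> + \<bar>x $ j\<bar>" .
    have "(\<Sum>b\<in>insert w E. ?c b * \<bar>x \<bullet> b\<bar>) = sqrt 2 * \<bar>x \<bullet> w\<bar> + (\<Sum>b\<in>E. ?c b * \<bar>x \<bullet> b\<bar>)"
      using notin(2) by simp
    also have "(\<Sum>b\<in>E. ?c b * \<bar>x \<bullet> b\<bar>) = (\<Sum>b\<in>E. \<bar>x \<bullet> b\<bar>)"
      using notin(2) by (intro sum.cong) auto
    also have "\<dots> = (\<Sum>k\<in>-{i,j}. \<bar>x $ k\<bar>)" by (simp add: E_def sum.reindex[OF inj] inner_axis)
    also have "sqrt 2 * \<bar>x \<bullet> w\<bar> + \<dots> \<le> (\<Sum>k\<in>{i,j}. \<bar>x $ k\<bar>) + (\<Sum>k\<in>-{i,j}. \<bar>x $ k\<bar>)"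
      using w ij by simp
    also have "\<dots> = (\<Sum>k\<in>UNIV. \<bar>x $ k\<bar>)"
      by (subst sum.union_disjoint[symmetric]) (auto intro!: sum.cong)
    also have "\<dots> \<le> 1" using x by (rule crosspolytope_l1_le)
    finally show ?thesis .
  qed
  have "prod ?c (insert w E) = sqrt 2 * prod ?c E" using notin(2) by simp
  also have "prod ?c E = 1" using notin(2) by (intro prod.neutral) auto
  finally have c: "prod ?c (insert w E) = sqrt 2" by simp
  have "proj_volume crosspolytope u \<le> 2 ^ (DIM(real ^ 'n) - 1) / (fact (DIM(real ^ 'n) - 1) * prod ?c (insert w E))"
    by (rule proj_volume_le[OF compact_crosspolytope frame notin(1) _ le]) auto
  then show ?thesis unfolding c by (simp add: u_def)
qed

section \<open>Pairing the coordinates and the final estimate\<close>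

text \<open>The involution swaps partners and fixes at most one element; the opposite signs will
  make the rows of two partners orthogonal. Each induction step adds one pair.\<close>

lemma ex_pairing:
  assumes "finite A"
  shows "\<exists>\<sigma> (s :: 'a \<Rightarrow> real). (\<forall>i\<in>A. \<sigma> i \<in> A \<and> \<sigma> (\<sigma> i) = i \<and> (s i = 1 \<or> s i = - 1) \<and>
      (\<sigma> i \<noteq> i \<longrightarrow> s (\<sigma> i) = - s i)) \<and> card {i \<in> A. \<sigma> i \<noteq> i} = 2 * (card A div 2)"
  using assms
proof (induction "card A" arbitrary: A rule: less_induct)
  case less
  show ?case
  proof (cases "card A \<ge> 2")
    case False
    then have "card A div 2 = 0" by simp
    then show ?thesis by (intro exI[of _ id] exI[of _ "\<lambda>_. 1"]) simp
  next
    case True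
    then obtain a b B where A: "A = insert a (insert b B)" "a \<noteq> b" "a \<notin> B" "b \<notin> B"
      using card_le_Suc_iff[of 1 A] by (auto simp: numeral_2_eq_2 card_le_Suc_iff)
    then have fin: "finite B" and card: "card A = Suc (Suc (card B))" using less.prems by auto
    obtain \<sigma> s where IH: "\<And>i. i \<in> B \<Longrightarrow> \<sigma> i \<in> B \<and> \<sigma> (\<sigma> i) = i \<and> (s i = 1 \<or> s i = - 1) \<and>
      (\<sigma> i \<noteq> i \<longrightarrow> s (\<sigma> i) = - (s i :: real))" "card {i \<in> B. \<sigma> i \<noteq> i} = 2 * (card B div 2)"
      using less.hyps[OF _ fin] card by auto
    let ?\<sigma> = "\<sigma>(a := b, b := a)" and ?s = "s(a := 1, b := - 1)"
    have "{i \<in> A. ?\<sigma> i \<noteq> i} = insert a (insert b {i \<in> B. \<sigma> i \<noteq> i})"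
      using A by auto
    then have "card {i \<in> A. ?\<sigma> i \<noteq> i} = 2 * (card A div 2)"
      using A fin IH(2) by (simp add: card)
    moreover have "\<forall>i\<in>A. ?\<sigma> i \<in> A \<and> ?\<sigma> (?\<sigma> i) = i \<and> (?s i = 1 \<or> ?s i = - 1) \<and>
      (?\<sigma> i \<noteq> i \<longrightarrow> ?s (?\<sigma> i) = - ?s i)"
    proof
      fix i assume "i \<in> A"
      \<comment> \<open>The partner of an element of \<open>B\<close> is again in \<open>B\<close>,
        so the updates at \<open>a\<close> and \<open>b\<close> do not affect it.\<close>
      then consider "i = a" | "i = b" | "i \<in> B" "i \<noteq> a" "i \<noteq> b" "\<sigma> i \<noteq> a" "\<sigma> i \<noteq> b"
        using A IH(1)[of i] by auto
      then show "?\<sigma> i \<in> A \<and> ?\<sigma> (?\<sigma> i) = i \<and> (?s i = 1 \<or> ?s i = - 1) \<and> (?\<sigma> i \<noteq> i \<longrightarrow> ?s (?\<sigma> i) = - ?s i)"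
        using A IH(1)[of i] by cases auto
    qed
    ultimately show ?thesis by blast
  qed
qed

text \<open>Integer division covers both parities: for odd dimension one coordinate is unpaired and
  contributes its axis to the frame.\<close>

lemma LW_constant_crosspolytope_ge:
  "fact (CARD('n) - 1) * 2 ^ (CARD('n) div 2) / real CARD('n) ^ (CARD('n) - 1)
    \<le> LW_constant (crosspolytope :: (real ^ 'n) set)"
proof -
  define n where "n = CARD('n)"
  define P :: real where "P = 2 ^ (n - 1) / fact (n - 1)"
  let ?C = "crosspolytope :: (real ^ 'n) set"
  obtain \<sigma> :: "'n \<Rightarrow> 'n" and s :: "'n \<Rightarrow> real" where
    \<sigma>: "\<And>i. \<sigma> (\<sigma> i) = i" and s: "\<And>i. s i = 1 \<or> s i = - 1"
    and s\<sigma>: "\<And>i. \<sigma> i \<noteq> i \<Longrightarrow> s (\<sigma> i) = - s i" and card: "card {i. \<sigma> i \<noteq> i} = 2 * (n div 2)"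
    using ex_pairing[of "UNIV :: 'n set"] by (auto simp: n_def)
  \<comment> \<open>For partners \<open>i\<close> and \<open>j = \<sigma> i\<close>, row
    \<open>j\<close> is the normalised \<open>axis i 1 - s i *\<^sub>R axis j 1\<close>, so the two
    rows are the two diagonals up to sign.\<close>
  define A :: "real ^ 'n ^ 'n" where "A = (\<chi> i. if \<sigma> i = i then axis i 1
    else (1 / sqrt 2) *\<^sub>R (s i *\<^sub>R axis i 1 + axis (\<sigma> i) 1))"
  have axis: "(axis k 1 :: real ^ 'n) \<bullet> axis l 1 = (if k = l then 1 else 0)" for k l
    by (simp add: inner_axis_axis)
  have ss: "s i * s i = 1" for i using s[of i] by auto
  have \<sigma>': "\<sigma> i = j \<longleftrightarrow> i = \<sigma> j" for i j using \<sigma> by metis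
  have rows: "A \<in> orthonormal_rows" unfolding orthonormal_rows_def
  proof (intro CollectI allI)
    fix i j
    consider "i = j" | "i \<noteq> j" "\<sigma> i = j" | "i \<noteq> j" "\<sigma> i \<noteq> j" by blast
    then show "A $ i \<bullet> A $ j = (if i = j then 1 else 0)"
    proof cases
      case 1
      then show ?thesis using ss[of i] by (auto simp: A_def inner_simps axis algebra_simps)
    next
      case 2
      \<comment> \<open>The inner product of the two rows is half of
        \<open>s i + s j\<close>.\<close>
      then have "\<sigma> j = i" "s j = - s i" using \<sigma> s\<sigma>[of i] by auto
      then show ?thesis using 2 by (simp add: A_def inner_simps axis algebra_simps)
    next
      case 3
      \<comment> \<open>Rows that do not belong to a common pair have disjoint supports.\<close>
      then have "\<sigma> j \<noteq> i" "\<sigma> i \<noteq> \<sigma> j" using \<sigma> by metis+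
      then show ?thesis using 3 by (auto simp: A_def inner_simps axis)
    qed
  qed
  have K: "compact ?C" "convex ?C" "interior ?C \<noteq> {}"
    by (simp_all add: compact_crosspolytope convex_crosspolytope interior_crosspolytope)
  have pos: "proj_volume ?C (A $ i) > 0" for i
    using norm_orthonormal_rows[OF rows] K by (rule proj_volume_pos)
  have "(\<Prod>i\<in>UNIV. proj_volume ?C (A $ i)) \<le> (\<Prod>i\<in>UNIV. P / (if \<sigma> i \<noteq> i then sqrt 2 else 1))"
  proof (rule prod_mono, intro conjI)
    fix i
    show "0 \<le> proj_volume ?C (A $ i)" using pos[of i] by simp
    show "proj_volume ?C (A $ i) \<le> P / (if \<sigma> i \<noteq> i then sqrt 2 else 1)"
      using proj_volume_crosspolytope_axis[of i] proj_volume_crosspolytope_diagonal[of i "\<sigma> i" "s i"] s[of i]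
      by (auto simp: A_def P_def n_def)
  qed
  \<comment> \<open>Each of the \<open>2 * (n div 2)\<close> paired indices contributes one factor
    \<open>sqrt 2\<close>.\<close>
  also have "\<dots> = P ^ n / sqrt 2 ^ card {i. \<sigma> i \<noteq> i}"
    by (simp add: prod_dividef prod.If_cases n_def)
  also have "sqrt 2 ^ card {i. \<sigma> i \<noteq> i} = 2 ^ (n div 2)"
    by (simp add: card power_mult)
  finally have le: "(\<Prod>i\<in>UNIV. proj_volume ?C (A $ i)) \<le> P ^ n / 2 ^ (n div 2)" .
  obtain m where m: "n = Suc m" unfolding n_def by (metis not0_implies_Suc zero_less_card_finite less_irrefl)
  have "fact (n - 1) * 2 ^ (n div 2) / real n ^ (n - 1) = (2 ^ n / fact n) ^ (n - 1) / (P ^ n / 2 ^ (n div 2))"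
  proof -
    define F :: real where "F = fact m"
    have "F > 0" by (simp add: F_def)
    \<comment> \<open>Here \<open>fact n = n * F\<close>; both powers of 2 have exponent
      \<open>n * m\<close> and cancel, and the powers of \<open>F\<close> cancel up to one
      factor.\<close>
    have "(2 ^ n / fact n) ^ (n - 1) / (P ^ n / 2 ^ (n div 2)) =
       ((2 ^ n) ^ m / (real n ^ m * F ^ m)) * (2 ^ (n div 2)) * (F ^ m * F / (2 ^ m) ^ n)"
      by (simp add: m P_def F_def power_divide power_mult_distrib)
    also have "(2 ^ m) ^ n = ((2 ^ n) ^ m :: real)" by (simp add: power_mult[symmetric] mult.commute)
    finally show ?thesis using \<open>F > 0\<close> by (simp add: m F_def)
  qed
  also have "\<dots> \<le> (2 ^ n / fact n) ^ (n - 1) / (\<Prod>i\<in>UNIV. proj_volume ?C (A $ i))"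
    using le pos by (intro divide_left_mono mult_pos_pos prod_pos) (auto simp: P_def)
  also have "\<dots> \<le> LW_constant ?C"
    using LW_constant_ge[OF K rows] by (simp add: measure_crosspolytope n_def)
  finally show ?thesis by (simp add: n_def)
qed

theorem theorem16:
  fixes n :: nat
  assumes "n = CARD('n::finite)" and "n \<ge> 2"
  shows "(even n \<longrightarrow>
            LW_constant (crosspolytope :: (real ^ 'n) set)
              \<ge> fact (n - 1) * 2 powr (real n / 2) / real n ^ (n - 1)) \<and>
         (odd n \<longrightarrow>
            LW_constant (crosspolytope :: (real ^ 'n) set)
              \<ge> fact (n - 1) * 2 powr ((real n - 1) / 2) / real n ^ (n - 1))"
proof -
  \<comment> \<open>For the respective parity, both real exponents are the integer
    \<open>n div 2\<close>.\<close>
  have "2 powr (real n / 2) = 2 ^ (n div 2)" if "even n"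
    using that by (auto simp: powr_realpow elim!: evenE)
  moreover have "2 powr ((real n - 1) / 2) = 2 ^ (n div 2)" if "odd n"
    using that by (auto simp: powr_realpow elim!: oddE)
  ultimately show ?thesis
    using LW_constant_crosspolytope_ge[where 'n = 'n] by (simp add: assms(1))
qed

end
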